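(* For every $r\geq1$ and every $\mathbf{s}=(s_1,\dots,s_r)\in\mathbb{Z}^r$, the finite multiple zeta value $\zeta_{\mathcal{A}_k}(\mathbf{s})$ is a $k$-linear combination of finite multiple zeta values $\zeta_{\mathcal{A}_k}(\mathbf{t})$ with all entries of $\mathbf{t}$ positive integers.
   Context: Fix a prime $p$ and a power $q$ of $p$; $A=\mathbb{F}_q[\theta]$, $k=\mathbb{F}_q(\theta)$. $\mathcal{A}_k=\prod_PA/(P)/\bigoplus_PA/(P)$, $P$ running over monic irreducible polynomials of $A$, a $k$-algebra. For $\mathbf{s}=(s_1,\dots,s_r)\in\mathbb{Z}^r$, $\zeta_{\mathcal{A}_k}(\mathbf{s})\in\mathcal{A}_k$ is the class of the tuple whose $P$-component is $\sum\frac{1}{a_1^{s_1}\cdots a_r^{s_r}}\in A/(P)$, the sum over monic $a_1,\dots,a_r\in A$ with $\deg P>\deg a_1>\cdots>\deg a_r\geq0$. The empty index (depth $0$) gives the value $1$, so $\mathbf{t}$ may be empty. *)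

theory Defs
  imports
    "HOL-Computational_Algebra.Computational_Algebra"
    "HOL-Number_Theory.Cong"
begin

text \<open>
  The coefficient field \<open>\<bbbF>\<^sub>q\<close> is an arbitrary type \<open>'a\<close> of sort \<open>{finite, field}\<close>, with
  \<open>q = CARD('a)\<close>. Then \<open>A\<close> is \<open>'a poly\<close> and \<open>k\<close> is \<open>'a poly fract\<close>.
\<close>

section \<open>Monic irreducible polynomials and residue fields\<close>

definition monic_irreducible :: "'a::field poly \<Rightarrow> bool" where
  "monic_irreducible P \<longleftrightarrow> lead_coeff P = 1 \<and> irreducible P"

text \<open>
  A representative of the inverse of \<open>a\<close> in \<open>A/(P)\<close>. It is unspecified if \<open>a\<close> is not
  invertible modulo \<open>P\<close>.
\<close>

definition inv_mod :: "'a::field poly \<Rightarrow> 'a poly \<Rightarrow> 'a poly" where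
  "inv_mod P a = (SOME b. [a * b = 1] (mod P))"

definition powi_mod :: "'a::field poly \<Rightarrow> 'a poly \<Rightarrow> int \<Rightarrow> 'a poly" where
  "powi_mod P a n = (if n \<ge> 0 then a ^ nat n else inv_mod P a ^ nat (- n))"

lemma monic_irreducible_X: "monic_irreducible [:0, 1 :: 'a::field:]"
  by (auto simp: monic_irreducible_def intro: irreducible_linear_field_poly)

lemma ex_inverse_mod:
  fixes P a :: "'a::field poly"
  assumes P: "irreducible P" and a: "\<not> P dvd a"
  shows "\<exists>b. [a * b = 1] (mod P)"
proof -
  let ?S = "{d. d \<noteq> 0 \<and> (\<exists>x y. d = a * x + P * y)}"
  have "P \<noteq> 0" using P by auto
  moreover have "P = a * 0 + P * 1" by simp
  ultimately have "P \<in> ?S" by blast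
  then obtain d where d: "d \<in> ?S" and min: "\<And>e. e \<in> ?S \<Longrightarrow> degree d \<le> degree e"
    using ex_has_least_nat[of "\<lambda>d. d \<in> ?S" P degree] by blast
  from d obtain x y where xy: "d = a * x + P * y" and d0: "d \<noteq> 0" by blast
  have dvd: "d dvd e" if "e = a * u + P * v" for e u v
  proof (rule ccontr)
    assume "\<not> d dvd e"
    hence nz: "e mod d \<noteq> 0" by (simp add: dvd_eq_mod_eq_0)
    have "e mod d = e - d * (e div d)" by (simp add: minus_mult_div_eq_mod)
    also have "\<dots> = a * (u - x * (e div d)) + P * (v - y * (e div d))"
      by (simp add: that xy algebra_simps)
    finally have "e mod d \<in> ?S" using nz by blast
    from min[OF this] degree_mod_less[OF d0, of e] nz show False by auto
  qed
  have "d dvd a" using dvd[of a 1 0] by simp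
  have "d dvd P" using dvd[of P 0 1] by simp
  then obtain c where c: "P = d * c" by (elim dvdE)
  have "is_unit d"
  proof (rule ccontr)
    assume "\<not> is_unit d"
    with P c have "is_unit c" unfolding irreducible_def by blast
    hence "P dvd d" using c by (simp add: mult_unit_dvd_iff)
    with \<open>d dvd a\<close> a show False using dvd_trans by blast
  qed
  then obtain u where "1 = d * u" by (elim dvdE)
  hence "1 = a * (x * u) + P * (y * u)" using xy by (simp add: algebra_simps)
  hence "a * (x * u) - 1 = P * (- (y * u))" by (simp add: algebra_simps)
  thus ?thesis unfolding cong_iff_dvd_diff by (metis dvd_triv_left)
qed

lemma cong_inv_mod:
  fixes P a :: "'a::field poly"
  assumes "irreducible P" "\<not> P dvd a"
  shows "[a * inv_mod P a = 1] (mod P)"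
  unfolding inv_mod_def by (rule someI_ex) (rule ex_inverse_mod[OF assms])

lemma finite_poly_degree_le: "finite {f :: 'a::{finite, field} poly. degree f \<le> n}"
proof (rule finite_subset)
  show "{f :: 'a poly. degree f \<le> n} \<subseteq> Poly ` {xs. set xs \<subseteq> UNIV \<and> length xs \<le> Suc n}"
  proof
    fix f :: "'a poly" assume "f \<in> {f. degree f \<le> n}"
    hence "length (coeffs f) \<le> Suc n" by (cases "f = 0") (auto simp: length_coeffs)
    thus "f \<in> Poly ` {xs. set xs \<subseteq> UNIV \<and> length xs \<le> Suc n}"
      by (intro image_eqI[of _ _ "coeffs f"]) auto
  qed
qed (intro finite_imageI finite_lists_length_le finite)

lemma finite_divisors_poly:
  fixes v :: "'a::{finite, field} poly"
  assumes "v \<noteq> 0"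
  shows "finite {P. monic_irreducible P \<and> P dvd v}"
  by (rule finite_subset[OF _ finite_poly_degree_le[of "degree v"]])
     (use assms in \<open>auto intro: dvd_imp_degree_le\<close>)

lemma ex_monic_irreducible_dvd:
  fixes f :: "'a::field poly"
  assumes "degree f > 0"
  shows "\<exists>P. monic_irreducible P \<and> P dvd f"
proof -
  obtain g where g: "degree g > 0" "g dvd f"
    and min: "\<And>h. degree h > 0 \<Longrightarrow> h dvd f \<Longrightarrow> degree g \<le> degree h"
    using ex_has_least_nat[of "\<lambda>g. degree g > 0 \<and> g dvd f" f degree] assms dvd_refl[of f]
    by blast
  have g0: "g \<noteq> 0" using g by auto
  define P where "P = smult (inverse (lead_coeff g)) g"
  have lc: "lead_coeff g \<noteq> 0" using g0 by simp
  have P0: "P \<noteq> 0" and deg: "degree P = degree g" using lc g0 by (simp_all add: P_def)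
  have "P dvd g" using lc by (simp add: P_def smult_dvd_iff)
  with g(2) have "P dvd f" using dvd_trans by blast
  have "irreducible P"
  proof (rule irreducibleI)
    show "\<not> is_unit P" using g deg by (auto simp: is_unit_iff_degree[OF P0])
    fix a b assume ab: "P = a * b"
    hence "a \<noteq> 0" "b \<noteq> 0" using P0 by auto
    moreover have "degree P = degree a + degree b"
      using ab calculation by (simp add: degree_mult_eq)
    moreover have "degree a > 0 \<Longrightarrow> degree P \<le> degree a"
      using min[of a] ab \<open>P dvd f\<close> deg by (metis dvd_trans dvd_triv_left)
    ultimately have "degree a = 0 \<or> degree b = 0" by linarith
    with \<open>a \<noteq> 0\<close> \<open>b \<noteq> 0\<close> show "is_unit a \<or> is_unit b" by (auto simp: is_unit_iff_degree)
  qed (use P0 in auto)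
  moreover have "lead_coeff P = 1" using lc by (simp add: P_def)
  ultimately show ?thesis using \<open>P dvd f\<close> by (auto simp: monic_irreducible_def)
qed

lemma infinite_monic_irreducible: "infinite {P :: 'a::field poly. monic_irreducible P}"
proof
  assume fin: "finite {P :: 'a poly. monic_irreducible P}"
  let ?N = "\<Prod>P | monic_irreducible P. P :: 'a poly"
  have N0: "?N \<noteq> 0" using fin by (auto simp: monic_irreducible_def)
  have "[:0, 1:] dvd ?N" using fin monic_irreducible_X by (intro dvd_prodI) auto
  hence "degree ?N > 0" using dvd_imp_degree_le[OF _ N0, of "[:0, 1:]"] by simp
  hence "degree (?N + 1) > 0" by (simp add: degree_add_eq_left)
  then obtain P where P: "monic_irreducible P" "P dvd ?N + 1"
    using ex_monic_irreducible_dvd by blast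
  have "P dvd ?N" using fin P by (intro dvd_prodI) auto
  with P have "P dvd 1" by (simp add: dvd_add_right_iff)
  with P show False by (auto simp: monic_irreducible_def irreducible_def)
qed

section \<open>The product \<open>\<Prod>\<^sub>P A/(P)\<close>\<close>

text \<open>
  An element is given by a family of representatives \<open>x P \<in> A\<close>, one for each monic irreducible
  \<open>P\<close>, taken modulo \<open>P\<close>. Values at other polynomials are irrelevant.
\<close>

quotient_type (overloaded) 'a residue_prod = "'a::field poly \<Rightarrow> 'a poly" /
    "\<lambda>x y. \<forall>P. monic_irreducible P \<longrightarrow> [x P = y P] (mod P)"
  by (intro equivpI reflpI sympI transpI) (auto intro: cong_sym cong_trans)

(* Otherwise lifting and transfer would also unfold polynomials to coefficient sequences. *)
lifting_forget poly.lifting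

lift_definition residues :: "('a::field poly \<Rightarrow> 'a poly) \<Rightarrow> 'a residue_prod" is "\<lambda>x. x" .

instantiation residue_prod :: (field) comm_ring_1
begin

lift_definition zero_residue_prod :: "'a residue_prod" is "\<lambda>_. 0" .
lift_definition one_residue_prod :: "'a residue_prod" is "\<lambda>_. 1" .
lift_definition plus_residue_prod :: "'a residue_prod \<Rightarrow> 'a residue_prod \<Rightarrow> 'a residue_prod"
  is "\<lambda>x y P. x P + y P" by (auto intro: cong_add)
lift_definition uminus_residue_prod :: "'a residue_prod \<Rightarrow> 'a residue_prod"
  is "\<lambda>x P. - x P" by (auto simp: cong_minus_minus_iff)
lift_definition minus_residue_prod :: "'a residue_prod \<Rightarrow> 'a residue_prod \<Rightarrow> 'a residue_prod"
  is "\<lambda>x y P. x P - y P" by (auto intro: cong_diff)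
lift_definition times_residue_prod :: "'a residue_prod \<Rightarrow> 'a residue_prod \<Rightarrow> 'a residue_prod"
  is "\<lambda>x y P. x P * y P" by (auto intro: cong_mult)

instance
proof
  show "(0 :: 'a residue_prod) \<noteq> 1"
  proof (transfer, rule)
    assume "\<forall>P::'a poly. monic_irreducible P \<longrightarrow> [0 = 1] (mod P)"
    hence "[0 = 1] (mod [:0, 1 :: 'a:])" using monic_irreducible_X by blast
    hence "[:0, 1 :: 'a:] dvd 1" by (metis cong_0_iff cong_sym)
    with monic_irreducible_X[where ?'a = 'a] show False
      by (auto simp: monic_irreducible_def irreducible_def)
  qed
qed (transfer; simp add: algebra_simps)+

end

section \<open>The ring \<open>\<A>\<^sub>k = \<Prod>\<^sub>P A/(P) / \<Oplus>\<^sub>P A/(P)\<close>\<close>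

lift_definition residue_supp :: "'a::field residue_prod \<Rightarrow> 'a poly set"
  is "\<lambda>x. {P. monic_irreducible P \<and> \<not> [x P = 0] (mod P)}"
  by (metis cong_def)

definition residue_sum :: "'a::field residue_prod set" where
  "residue_sum = {x. finite (residue_supp x)}"

lemma residue_sum_0: "0 \<in> residue_sum"
  unfolding residue_sum_def by (simp, transfer, simp)

lemma residue_sum_add: "x \<in> residue_sum \<Longrightarrow> y \<in> residue_sum \<Longrightarrow> x + y \<in> residue_sum"
proof -
  have "residue_supp (x + y) \<subseteq> residue_supp x \<union> residue_supp y"
    by transfer (auto dest: cong_add)
  thus "x \<in> residue_sum \<Longrightarrow> y \<in> residue_sum \<Longrightarrow> x + y \<in> residue_sum"
    unfolding residue_sum_def by (auto intro: finite_subset)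
qed

lemma residue_sum_mult: "x \<in> residue_sum \<Longrightarrow> y * x \<in> residue_sum"
proof -
  have "residue_supp (y * x) \<subseteq> residue_supp x"
    by transfer (auto simp: cong_0_iff)
  thus "x \<in> residue_sum \<Longrightarrow> y * x \<in> residue_sum"
    unfolding residue_sum_def by (auto intro: finite_subset)
qed

lemma residue_sum_uminus: "x \<in> residue_sum \<Longrightarrow> - x \<in> residue_sum"
  using residue_sum_mult[of x "-1"] by simp

lemma residue_supp_one: "residue_supp (1 :: 'a::field residue_prod) = {P. monic_irreducible P}"
  by transfer (auto simp: cong_0_iff monic_irreducible_def irreducible_def)

lemma residue_supp_diff_residues:
  "residue_supp (residues x - residues y) = {P. monic_irreducible P \<and> \<not> [x P = y P] (mod P)}"
  by transfer (auto simp: cong_iff_dvd_diff)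

lemma residues_add: "residues x + residues y = residues (\<lambda>P. x P + y P)"
  by transfer simp

lemma residues_mult: "residues x * residues y = residues (\<lambda>P. x P * y P)"
  by transfer simp

lemma residues_one: "residues (\<lambda>_. 1) = 1"
  by transfer simp

lifting_forget residue_prod.lifting

quotient_type (overloaded) 'a adele = "'a::field residue_prod" / "\<lambda>x y. x - y \<in> residue_sum"
proof (intro equivpI reflpI sympI transpI)
  fix x y z :: "'a residue_prod"
  show "x - x \<in> residue_sum" by (simp add: residue_sum_0)
  show "y - x \<in> residue_sum" if "x - y \<in> residue_sum"
    using residue_sum_uminus[OF that] by simp
  show "x - z \<in> residue_sum" if "x - y \<in> residue_sum" "y - z \<in> residue_sum"
    using residue_sum_add[OF that] by simp
qed

lift_definition to_adele :: "'a::field residue_prod \<Rightarrow> 'a adele" is "\<lambda>x. x" .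

instantiation adele :: (field) comm_ring_1
begin

lift_definition zero_adele :: "'a adele" is 0 .
lift_definition one_adele :: "'a adele" is 1 .
lift_definition plus_adele :: "'a adele \<Rightarrow> 'a adele \<Rightarrow> 'a adele" is "(+)"
  by (drule (1) residue_sum_add) (simp add: algebra_simps)
lift_definition uminus_adele :: "'a adele \<Rightarrow> 'a adele" is uminus
  by (drule residue_sum_uminus) simp
lift_definition minus_adele :: "'a adele \<Rightarrow> 'a adele \<Rightarrow> 'a adele" is "(-)"
  by (drule residue_sum_add, erule residue_sum_uminus) (simp add: algebra_simps)
lift_definition times_adele :: "'a adele \<Rightarrow> 'a adele \<Rightarrow> 'a adele" is "(*)"
proof -
  fix x x' y y' :: "'a residue_prod"
  assume "x - x' \<in> residue_sum" "y - y' \<in> residue_sum"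
  hence "y * (x - x') + x' * (y - y') \<in> residue_sum"
    by (intro residue_sum_add residue_sum_mult)
  thus "x * y - x' * y' \<in> residue_sum" by (simp add: algebra_simps)
qed

instance
proof
  show "(0 :: 'a adele) \<noteq> 1"
  proof
    assume "(0 :: 'a adele) = 1"
    hence "(1 :: 'a residue_prod) \<in> residue_sum"
      by transfer (use residue_sum_uminus in fastforce)
    thus False
      using infinite_monic_irreducible[where ?'a = 'a]
      by (simp add: residue_sum_def residue_supp_one)
  qed
qed (transfer; simp add: algebra_simps residue_sum_0)+

end

lemma to_adele_residues_eq_iff:
  "to_adele (residues x) = to_adele (residues y) \<longleftrightarrow>
     finite {P. monic_irreducible P \<and> \<not> [x P = y P] (mod P)}"
proof -
  have "to_adele (residues x) = to_adele (residues y) \<longleftrightarrow>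
      residues x - residues y \<in> residue_sum"
    by transfer simp
  thus ?thesis by (simp add: residue_sum_def residue_supp_diff_residues)
qed

section \<open>The \<open>k\<close>-algebra structure\<close>

text \<open>
  The fraction \<open>u / v\<close> acts in the \<open>P\<close>-component as \<open>u v\<^sup>-\<^sup>1\<close>, which makes sense for all \<open>P\<close> that
  do not divide \<open>v\<close>, hence for all but finitely many \<open>P\<close>. The class does not depend on the choice of \<open>u\<close> and \<open>v\<close>
  (see \<open>adele_of_fract_Fract\<close>).
\<close>

lemma fract_residue_cong:
  fixes u v u' v' P :: "'a::field poly"
  assumes "irreducible P" "\<not> P dvd v" "\<not> P dvd v'" "u * v' = u' * v"
  shows "[u * inv_mod P v = u' * inv_mod P v'] (mod P)"
proof -
  let ?i = "inv_mod P v" and ?i' = "inv_mod P v'"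
  note i = cong_inv_mod[OF assms(1,2)] and i' = cong_inv_mod[OF assms(1,3)]
  have "[u * ?i * 1 = u * ?i * (v' * ?i')] (mod P)"
    by (intro cong_mult cong_refl cong_sym[OF i'])
  also have "u * ?i * (v' * ?i') = (u * v') * (?i * ?i')" by (simp add: ac_simps)
  also have "\<dots> = u' * ?i' * (v * ?i)" unfolding assms(4) by (simp add: ac_simps)
  also have "[\<dots> = u' * ?i' * 1] (mod P)" by (intro cong_mult cong_refl i)
  finally show ?thesis by simp
qed

lemma to_adele_residues_eqI:
  fixes v :: "'a::{finite, field} poly"
  assumes "v \<noteq> 0"
    and "\<And>P. irreducible P \<Longrightarrow> \<not> P dvd v \<Longrightarrow> [x P = y P] (mod P)"
  shows "to_adele (residues x) = to_adele (residues y)"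
  unfolding to_adele_residues_eq_iff
  by (rule finite_subset[OF _ finite_divisors_poly[OF assms(1)]])
     (use assms(2) in \<open>auto simp: monic_irreducible_def\<close>)

definition adele_of_fract :: "'a::{finite, field} poly fract \<Rightarrow> 'a adele" where
  "adele_of_fract c = (THE x. \<exists>u v. v \<noteq> 0 \<and> c = Fract u v \<and>
     x = to_adele (residues (\<lambda>P. u * inv_mod P v)))"

lemma adele_of_fract_Fract:
  fixes u v :: "'a::{finite, field} poly"
  assumes v: "v \<noteq> 0"
  shows "adele_of_fract (Fract u v) = to_adele (residues (\<lambda>P. u * inv_mod P v))"
  unfolding adele_of_fract_def
proof (rule the_equality)
  fix x :: "'a adele"
  assume "\<exists>u' v'. v' \<noteq> 0 \<and> Fract u v = Fract u' v' \<and>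
    x = to_adele (residues (\<lambda>P. u' * inv_mod P v'))"
  then obtain u' v' where v': "v' \<noteq> 0" and eq: "Fract u v = Fract u' v'"
    and x: "x = to_adele (residues (\<lambda>P. u' * inv_mod P v'))"
    by blast
  have *: "u' * v = u * v'" using eq v v' by (simp add: eq_fract)
  show "x = to_adele (residues (\<lambda>P. u * inv_mod P v))"
    unfolding x
  proof (rule to_adele_residues_eqI)
    show "v * v' \<noteq> 0" using v v' by simp
    fix P :: "'a poly" assume "irreducible P" "\<not> P dvd v * v'"
    thus "[u' * inv_mod P v' = u * inv_mod P v] (mod P)"
      using * by (intro fract_residue_cong) auto
  qed
qed (use v in blast)

lemma to_adele_residues_add:
  "to_adele (residues x) + to_adele (residues y) = to_adele (residues (\<lambda>P. x P + y P))"
  unfolding residues_add[symmetric] by transfer (simp add: residue_sum_0)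

lemma to_adele_residues_mult:
  "to_adele (residues x) * to_adele (residues y) = to_adele (residues (\<lambda>P. x P * y P))"
  unfolding residues_mult[symmetric] by transfer (simp add: residue_sum_0)

lemma one_adele_residues: "1 = to_adele (residues (\<lambda>_. 1))"
  unfolding residues_one by transfer (simp add: residue_sum_0)

lemma cong_mult_lcancel_irreducible:
  fixes P c x y :: "'a::field poly"
  assumes "irreducible P" "\<not> P dvd c" "[c * x = c * y] (mod P)"
  shows "[x = y] (mod P)"
proof -
  have "P dvd c * (x - y)" using assms(3) by (simp add: cong_iff_dvd_diff algebra_simps)
  thus ?thesis
    using assms(1,2) field_poly_irreducible_imp_prime[of P]
    by (auto simp: cong_iff_dvd_diff prime_elem_dvd_mult_iff)
qed

lemma cong_inv_mod_1: "irreducible P \<Longrightarrow> [inv_mod P 1 = 1] (mod P)"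
  using cong_inv_mod[of P 1] by (auto simp: irreducible_def)

lemma adele_of_fract_1: "adele_of_fract (1 :: 'a::{finite, field} poly fract) = 1"
proof -
  have "to_adele (residues (\<lambda>P :: 'a poly. 1 * inv_mod P 1)) = to_adele (residues (\<lambda>_. 1))"
    by (rule to_adele_residues_eqI[of 1]) (simp_all add: cong_inv_mod_1)
  thus ?thesis by (simp add: One_fract_def adele_of_fract_Fract one_adele_residues)
qed

lemma adele_of_fract_mult:
  fixes c d :: "'a::{finite, field} poly fract"
  shows "adele_of_fract (c * d) = adele_of_fract c * adele_of_fract d"
proof (cases c, cases d)
  fix u v u' v' :: "'a poly"
  assume c: "c = Fract u v" "v \<noteq> 0" and d: "d = Fract u' v'" "v' \<noteq> 0"
  have "to_adele (residues (\<lambda>P. u * u' * inv_mod P (v * v'))) =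
      to_adele (residues (\<lambda>P. u * inv_mod P v * (u' * inv_mod P v')))"
  proof (rule to_adele_residues_eqI)
    show "v * v' \<noteq> 0" using c d by simp
    fix P :: "'a poly" assume P: "irreducible P" "\<not> P dvd v * v'"
    hence P': "\<not> P dvd v" "\<not> P dvd v'" by auto
    let ?i = "inv_mod P v" and ?i' = "inv_mod P v'" and ?j = "inv_mod P (v * v')"
    have "v * v' * (u * u' * ?j) = u * u' * (v * v' * ?j)" by (simp only: ac_simps)
    also have "[\<dots> = u * u' * 1] (mod P)"
      by (intro cong_mult cong_refl cong_inv_mod[OF P])
    finally have 1: "[v * v' * (u * u' * ?j) = u * u' * 1] (mod P)" .
    have "v * v' * (u * ?i * (u' * ?i')) = u * u' * ((v * ?i) * (v' * ?i'))"
      by (simp only: ac_simps)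
    also have "[\<dots> = u * u' * (1 * 1)] (mod P)"
      by (intro cong_mult cong_refl cong_inv_mod[OF P(1) P'(1)] cong_inv_mod[OF P(1) P'(2)])
    finally have 2: "[v * v' * (u * ?i * (u' * ?i')) = u * u' * 1] (mod P)" by simp
    show "[u * u' * ?j = u * ?i * (u' * ?i')] (mod P)"
      by (rule cong_mult_lcancel_irreducible[OF P cong_trans[OF 1 cong_sym[OF 2]]])
  qed
  thus ?thesis using c d by (simp add: adele_of_fract_Fract to_adele_residues_mult)
qed

lemma adele_of_fract_add:
  fixes c d :: "'a::{finite, field} poly fract"
  shows "adele_of_fract (c + d) = adele_of_fract c + adele_of_fract d"
proof (cases c, cases d)
  fix u v u' v' :: "'a poly"
  assume c: "c = Fract u v" "v \<noteq> 0" and d: "d = Fract u' v'" "v' \<noteq> 0"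
  have "to_adele (residues (\<lambda>P. (u * v' + u' * v) * inv_mod P (v * v'))) =
      to_adele (residues (\<lambda>P. u * inv_mod P v + u' * inv_mod P v'))"
  proof (rule to_adele_residues_eqI)
    show "v * v' \<noteq> 0" using c d by simp
    fix P :: "'a poly" assume P: "irreducible P" "\<not> P dvd v * v'"
    hence P': "\<not> P dvd v" "\<not> P dvd v'" by auto
    let ?i = "inv_mod P v" and ?i' = "inv_mod P v'" and ?j = "inv_mod P (v * v')"
    have "v * v' * ((u * v' + u' * v) * ?j) = (u * v' + u' * v) * (v * v' * ?j)"
      by (simp only: ac_simps)
    also have "[\<dots> = (u * v' + u' * v) * 1] (mod P)"
      by (intro cong_mult cong_refl cong_inv_mod[OF P])
    finally have 1: "[v * v' * ((u * v' + u' * v) * ?j) = u * v' + u' * v] (mod P)" by simp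
    have "v * v' * (u * ?i + u' * ?i') = u * v' * (v * ?i) + u' * v * (v' * ?i')"
      by (simp only: distrib_left ac_simps)
    also have "[\<dots> = u * v' * 1 + u' * v * 1] (mod P)"
      by (intro cong_add cong_mult cong_refl cong_inv_mod[OF P(1) P'(1)]
        cong_inv_mod[OF P(1) P'(2)])
    finally have 2: "[v * v' * (u * ?i + u' * ?i') = u * v' + u' * v] (mod P)" by simp
    show "[(u * v' + u' * v) * ?j = u * ?i + u' * ?i'] (mod P)"
      by (rule cong_mult_lcancel_irreducible[OF P cong_trans[OF 1 cong_sym[OF 2]]])
  qed
  thus ?thesis using c d by (simp add: adele_of_fract_Fract to_adele_residues_add)
qed

definition adele_scale :: "'a::{finite, field} poly fract \<Rightarrow> 'a adele \<Rightarrow> 'a adele" where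
  "adele_scale c x = adele_of_fract c * x"

global_interpretation adele: vector_space adele_scale
  by unfold_locales
     (simp_all add: adele_scale_def adele_of_fract_add adele_of_fract_mult adele_of_fract_1
       algebra_simps)

section \<open>Finite multiple zeta values\<close>

text \<open>The tuples \<open>[a\<^sub>1, \<dots>, a\<^sub>r]\<close> of monic polynomials with \<open>deg P > deg a\<^sub>1 > \<dots> > deg a\<^sub>r \<ge> 0\<close>.\<close>

definition zeta_tuples :: "'a::field poly \<Rightarrow> nat \<Rightarrow> 'a poly list set" where
  "zeta_tuples P r = {as. length as = r \<and> (\<forall>a\<in>set as. lead_coeff a = 1) \<and>
     sorted_wrt (\<lambda>f g. degree f > degree g) (P # as)}"

text \<open>
  In every summand \<open>1 / (a\<^sub>1\<^bsup>s\<^sub>1\<^esup> \<dots> a\<^sub>r\<^bsup>s\<^sub>r\<^esup>)\<close> the \<open>a\<^sub>i\<close> are invertible modulo \<open>P\<close>, since they are nonzero of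
  degree less than \<open>deg P\<close>.
\<close>

definition finite_mzv :: "int list \<Rightarrow> 'a::{finite, field} adele" where
  "finite_mzv s = to_adele (residues (\<lambda>P.
     \<Sum>as\<in>zeta_tuples P (length s). inv_mod P (\<Prod>i<length s. powi_mod P (as ! i) (s ! i))))"

lemma finite_zeta_tuples: "finite (zeta_tuples (P :: 'a::{finite, field} poly) r)"
  by (rule finite_subset[OF _ finite_lists_length_eq[OF finite_poly_degree_le[of "degree P"], of r]])
     (auto simp: zeta_tuples_def)

lemma finite_mzv_Nil: "finite_mzv [] = (1 :: 'a::{finite, field} adele)"
proof -
  have "zeta_tuples P 0 = {[]}" for P :: "'a poly" by (auto simp: zeta_tuples_def)
  hence "finite_mzv [] = to_adele (residues (\<lambda>P :: 'a poly. inv_mod P 1))"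
    by (simp add: finite_mzv_def)
  also have "\<dots> = to_adele (residues (\<lambda>_. 1))"
    by (rule to_adele_residues_eqI[of 1]) (simp_all add: cong_inv_mod_1)
  finally show ?thesis by (simp only: one_adele_residues)
qed

end

theory Submission
  imports Defs
begin

text \<open>
  For \<open>n \<le> 0\<close> the power sum \<open>S\<^sub>d(n) = \<Sum> a\<^sup>-\<^sup>n\<close> over the monic \<open>a\<close> of degree \<open>d\<close> vanishes once \<open>d > -n\<close>.
  Let \<open>n\<close> be the first non-positive entry of \<open>s\<close>, say \<open>s = u @ n # v\<close>. As a function of the degree
  bound \<open>d\<close>, the inner sum belonging to \<open>n # v\<close> has values in \<open>k\<close> and is eventually constant.
  An iterated sum over a positive index \<open>u\<close> with such a weight \<open>g\<close> lies in the span, by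
  induction on the length of \<open>u\<close>: writing \<open>g\<close> as its limit \<open>C\<close> plus a finitely supported function,
  the first part gives \<open>C\<close> times the zeta value of \<open>u\<close>, and summing the second part
  over the last entry of \<open>u\<close> gives again an eventually constant weight, for a shorter index.
\<close>

section \<open>Vanishing of power sums\<close>

text \<open>The shift by 1 permutes the field, so the sum of all elements equals itself plus
  \<open>q\<close> times 1.\<close>

lemma of_nat_card_finite_field: "of_nat (card (UNIV :: 'a set)) = (0 :: 'a::{finite, field})"
proof -
  have "(\<Sum>c\<in>UNIV. c :: 'a) = (\<Sum>c\<in>UNIV. c + 1)"
    by (rule sum.reindex_bij_witness[of _ "\<lambda>c. c + 1" "\<lambda>c. c - 1"]) auto
  thus ?thesis by (simp add: sum.distrib)
qed

lemma lead_coeff_pcompose_shift: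
  fixes h :: "'b::idom poly"
  shows "coeff (h \<circ>\<^sub>p [:b, 1:]) (degree h) = lead_coeff h"
  using lead_coeff_comp[of "[:b, 1:]" h] by (simp add: degree_pcompose)

text \<open>All \<open>q\<close> shifts share the leading coefficient of \<open>h\<close>, so the
  coefficients at \<open>degree h\<close> add up to \<open>q\<close> times it, which is 0. For
  constant \<open>h\<close> this forces \<open>H = 0\<close>.\<close>

lemma degree_sum_shifts_less:
  fixes h :: "'a::{finite, field} poly poly" and d :: nat
  defines "H \<equiv> (\<Sum>c\<in>UNIV. h \<circ>\<^sub>p [:monom c d, 1:])"
  shows "H = 0 \<or> degree H < degree h"
proof -
  have "degree H \<le> degree h"
    unfolding H_def by (rule degree_sum_le) (auto simp: degree_pcompose)
  moreover have "(of_nat (card (UNIV :: 'a set)) :: 'a poly) = 0"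
    by (simp add: of_nat_poly of_nat_card_finite_field)
  hence "coeff H (degree h) = 0"
    by (simp add: H_def coeff_sum lead_coeff_pcompose_shift)
  ultimately show ?thesis
    by (metis leading_coeff_0_iff le_neq_implies_less)
qed

text \<open>Summing first over the top coefficient \<open>c\<close> of \<open>v\<close> replaces
  \<open>h\<close> by the sum of its shifts, whose degree is smaller. The condition on coefficients
  describes degree below \<open>d\<close> and admits \<open>v = 0\<close> even for
  \<open>d = 0\<close>.\<close>

lemma sum_poly_low_degree_eq_0:
  fixes h :: "'a::{finite, field} poly poly"
  assumes "degree h < d"
  shows "(\<Sum>v | \<forall>i\<ge>d. coeff v i = 0. poly h v) = 0"
  using assms
proof (induction d arbitrary: h)
  case 0
  thus ?case by simp
next
  case (Suc d)
  let ?V = "\<lambda>d. {v :: 'a poly. \<forall>i\<ge>d. coeff v i = 0}"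
  define H where "H = (\<Sum>c\<in>UNIV. h \<circ>\<^sub>p [:monom c d, 1:])"
  have "(\<Sum>v\<in>?V (Suc d). poly h v) = (\<Sum>(v, c)\<in>?V d \<times> UNIV. poly h (v + monom c d))"
    by (rule sum.reindex_bij_witness[of _ "\<lambda>(v, c). v + monom c d"
          "\<lambda>w. (w - monom (coeff w d) d, coeff w d)"])
       (auto simp: Suc_le_eq order.order_iff_strict[of d])
  also have "\<dots> = (\<Sum>v\<in>?V d. poly H v)"
    by (simp add: sum.cartesian_product[symmetric] H_def poly_sum poly_pcompose add.commute)
  \<comment> \<open>The case \<open>H = 0\<close> stands apart because for \<open>d = 0\<close> the
    induction hypothesis does not cover it.\<close>
  also have "\<dots> = 0"
    using degree_sum_shifts_less[of h d] Suc.prems Suc.IH[of H]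
    by (cases "H = 0") (auto simp: H_def[symmetric])
  finally show ?case .
qed

definition monics :: "nat \<Rightarrow> 'a::field poly set" where
  "monics d = {a. lead_coeff a = 1 \<and> degree a = d}"

lemma finite_monics: "finite (monics d :: 'a::{finite, field} poly set)"
  by (rule finite_subset[OF _ finite_poly_degree_le[of d]]) (auto simp: monics_def)

text \<open>Monic polynomials of degree \<open>d\<close> are \<open>monom 1 d + v\<close> with
  \<open>v\<close> of degree below \<open>d\<close>, and their \<open>m\<close>-th power is the
  value at \<open>v\<close> of a polynomial of degree \<open>m\<close> over
  \<open>A\<close>.\<close>

lemma sum_monics_power_eq_0:
  assumes "m < d"
  shows "(\<Sum>a\<in>monics d. a ^ m) = (0 :: 'a::{finite, field} poly)"
proof -
  define h :: "'a poly poly" where "h = [:monom 1 d, 1:] ^ m"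
  have "(\<Sum>a\<in>monics d. a ^ m) = (\<Sum>v | \<forall>i\<ge>d. coeff v i = 0. poly h v)"
  proof (rule sum.reindex_bij_witness[of _ "\<lambda>v. monom 1 d + v" "\<lambda>a. a - monom 1 d"])
    fix a :: "'a poly" assume a: "a \<in> monics d"
    thus "a - monom 1 d \<in> {v. \<forall>i\<ge>d. coeff v i = 0}"
      by (auto simp: monics_def coeff_eq_0)
  next
    fix v :: "'a poly" assume v: "v \<in> {v. \<forall>i\<ge>d. coeff v i = 0}"
    have "degree (monom 1 d + v) = d"
      using v by (intro antisym degree_le le_degree) auto
    with v show "monom 1 d + v \<in> monics d"
      by (simp add: monics_def)
  qed (simp_all add: h_def)
  also have "\<dots> = 0"
    using assms by (intro sum_poly_low_degree_eq_0) (simp add: h_def degree_power_eq)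
  finally show ?thesis .
qed

section \<open>Inverses modulo an irreducible polynomial\<close>

lemma not_dvd_monics:
  "irreducible P \<Longrightarrow> a \<in> monics d \<Longrightarrow> d < degree P \<Longrightarrow> \<not> P dvd a"
  by (auto simp: monics_def dest: dvd_imp_degree_le)

lemma not_dvd_mult_irreducible:
  fixes P :: "'a::field poly"
  shows "irreducible P \<Longrightarrow> \<not> P dvd a \<Longrightarrow> \<not> P dvd b \<Longrightarrow> \<not> P dvd a * b"
  by (simp add: field_poly_irreducible_imp_prime prime_elem_dvd_mult_iff)

lemma not_dvd_power_irreducible:
  fixes P :: "'a::field poly"
  shows "irreducible P \<Longrightarrow> \<not> P dvd a \<Longrightarrow> \<not> P dvd a ^ n"
  using field_poly_irreducible_imp_prime prime_elem_dvd_power by blast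

lemma not_dvd_prod_irreducible:
  fixes P :: "'a::field poly"
  assumes "irreducible P" "\<And>i. i \<in> I \<Longrightarrow> \<not> P dvd f i"
  shows "\<not> P dvd prod f I"
  using assms(2)
  by (induction I rule: infinite_finite_induct)
     (use assms(1) in \<open>auto simp: irreducible_not_unit not_dvd_mult_irreducible\<close>)

lemma not_dvd_inv_mod:
  fixes P :: "'a::field poly"
  assumes "irreducible P" "\<not> P dvd a"
  shows "\<not> P dvd inv_mod P a"
proof
  assume "P dvd inv_mod P a"
  hence "P dvd a * inv_mod P a" by simp
  hence "P dvd 1" using cong_inv_mod[OF assms] cong_dvd_iff by blast
  with assms(1) show False by (simp add: irreducible_def)
qed

lemma not_dvd_powi_mod:
  fixes P :: "'a::field poly"
  shows "irreducible P \<Longrightarrow> \<not> P dvd a \<Longrightarrow> \<not> P dvd powi_mod P a n"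
  by (simp add: powi_mod_def not_dvd_power_irreducible not_dvd_inv_mod)

lemma inv_mod_unique:
  fixes P :: "'a::field poly"
  assumes "irreducible P" "\<not> P dvd a" "[a * b = 1] (mod P)"
  shows "[inv_mod P a = b] (mod P)"
  by (rule cong_mult_lcancel_irreducible[OF assms(1,2)])
     (rule cong_trans[OF cong_inv_mod[OF assms(1,2)] cong_sym[OF assms(3)]])

lemma inv_mod_mult:
  fixes P :: "'a::field poly"
  assumes "irreducible P" "\<not> P dvd a" "\<not> P dvd b"
  shows "[inv_mod P (a * b) = inv_mod P a * inv_mod P b] (mod P)"
proof (rule inv_mod_unique)
  have "[(a * inv_mod P a) * (b * inv_mod P b) = 1 * 1] (mod P)"
    using assms by (intro cong_mult cong_inv_mod)
  thus "[a * b * (inv_mod P a * inv_mod P b) = 1] (mod P)" by (simp add: ac_simps)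
qed (use assms not_dvd_mult_irreducible in auto)

text \<open>Two inversions cancel, which leaves a polynomial that does not depend on
  \<open>P\<close>.\<close>

lemma inv_mod_powi_mod_nonpos:
  fixes P :: "'a::field poly"
  assumes "irreducible P" "\<not> P dvd a" "n \<le> 0"
  shows "[inv_mod P (powi_mod P a n) = a ^ nat (- n)] (mod P)"
proof (rule inv_mod_unique)
  have "[(a * inv_mod P a) ^ nat (- n) = 1 ^ nat (- n)] (mod P)"
    using assms by (intro cong_pow cong_inv_mod)
  thus "[powi_mod P a n * a ^ nat (- n) = 1] (mod P)"
    using \<open>n \<le> 0\<close> by (auto simp: powi_mod_def power_mult_distrib mult.commute)
qed (use assms not_dvd_powi_mod in auto)

section \<open>Iterated sums\<close>

text \<open>\<open>D\<close> is a strict bound for the outermost degree. The weight \<open>g\<close>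
  stands in place of the empty product 1, so that it can absorb the tail of an index.\<close>

fun iterated_sum :: "(nat \<Rightarrow> 'n \<Rightarrow> 'b::comm_ring_1) \<Rightarrow> (nat \<Rightarrow> 'b) \<Rightarrow> 'n list \<Rightarrow> nat \<Rightarrow> 'b" where
  "iterated_sum S g [] D = g D"
| "iterated_sum S g (n # s) D = (\<Sum>d<D. S d n * iterated_sum S g s d)"

lemma iterated_sum_append:
  "iterated_sum S g (u @ w) D = iterated_sum S (iterated_sum S g w) u D"
  by (induction u arbitrary: D) auto

lemma iterated_sum_add:
  "iterated_sum S (\<lambda>d. f d + g d) u D = iterated_sum S f u D + iterated_sum S g u D"
  by (induction u arbitrary: D) (auto simp: sum.distrib distrib_left)

lemma iterated_sum_mult_left:
  "iterated_sum S (\<lambda>d. c * g d) u D = c * iterated_sum S g u D"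
  by (induction u arbitrary: D) (auto simp: sum_distrib_left mult.left_commute)

text \<open>Write \<open>g\<close> as \<open>c\<close> plus \<open>g - c\<close>; in the second part
  the summation for \<open>n\<close> moves into the weight, which shortens the index.\<close>

lemma iterated_sum_snoc_split:
  "iterated_sum S g (u @ [n]) D = c * iterated_sum S (\<lambda>_. 1) (u @ [n]) D
     + iterated_sum S (\<lambda>d. \<Sum>e<d. S e n * (g e - c)) u D"
proof -
  have "iterated_sum S g (u @ [n]) D = iterated_sum S (\<lambda>d. c * 1 + (g d - c)) (u @ [n]) D"
    by simp
  also have "\<dots> = c * iterated_sum S (\<lambda>_. 1) (u @ [n]) D
      + iterated_sum S (\<lambda>d. g d - c) (u @ [n]) D"
    by (simp only: iterated_sum_add iterated_sum_mult_left)
  also have "iterated_sum S (\<lambda>d. g d - c) (u @ [n]) D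
      = iterated_sum S (\<lambda>d. \<Sum>e<d. S e n * (g e - c)) u D"
  proof -
    have "iterated_sum S (\<lambda>d. g d - c) [n] = (\<lambda>d. \<Sum>e<d. S e n * (g e - c))" by (rule ext) simp
    thus ?thesis by (simp only: iterated_sum_append)
  qed
  finally show ?thesis .
qed

section \<open>Power sums modulo \<open>P\<close>\<close>

definition power_sum :: "'a::field poly \<Rightarrow> nat \<Rightarrow> int \<Rightarrow> 'a poly" where
  "power_sum P d n = (\<Sum>a\<in>monics d. inv_mod P (powi_mod P a n))"

lemma power_sum_nonpos_cong_0:
  fixes P :: "'a::{finite, field} poly"
  assumes "irreducible P" "n \<le> 0" "nat (- n) < d" "d < degree P"
  shows "[power_sum P d n = 0] (mod P)"
proof -
  have "[power_sum P d n = (\<Sum>a\<in>monics d. a ^ nat (- n))] (mod P)"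
    unfolding power_sum_def
    using assms by (intro cong_sum inv_mod_powi_mod_nonpos not_dvd_monics)
  thus ?thesis using assms by (simp add: sum_monics_power_eq_0)
qed

section \<open>Finite zeta values as iterated sums\<close>

text \<open>The bound \<open>D\<close> is decoupled from \<open>degree P\<close> so that tails of
  tuples are again of this form.\<close>

definition tuples_below :: "nat \<Rightarrow> nat \<Rightarrow> 'a::field poly list set" where
  "tuples_below D r = {as. length as = r \<and> (\<forall>a\<in>set as. lead_coeff a = 1 \<and> degree a < D) \<and>
     sorted_wrt (\<lambda>f g. degree f > degree g) as}"

lemma zeta_tuples_eq: "zeta_tuples P r = tuples_below (degree P) r"
  by (auto simp: zeta_tuples_def tuples_below_def)

lemma finite_tuples_below: "finite (tuples_below D r :: 'a::{finite, field} poly list set)"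
  by (rule finite_subset[OF _ finite_lists_length_eq[OF finite_poly_degree_le[of D], of r]])
     (auto simp: tuples_below_def less_imp_le)

lemma sum_tuples_below_Suc:
  fixes F :: "'a::{finite, field} poly list \<Rightarrow> 'b::comm_monoid_add"
  shows "sum F (tuples_below D (Suc r)) =
    (\<Sum>d<D. \<Sum>a\<in>monics d. \<Sum>as\<in>tuples_below d r. F (a # as))"
proof -
  have "(\<Sum>d<D. \<Sum>a\<in>monics d. \<Sum>as\<in>tuples_below d r. F (a # as)) =
      (\<Sum>(d, a, as)\<in>Sigma {..<D} (\<lambda>d. monics d \<times> tuples_below d r). F (a # as))"
    by (simp add: sum.Sigma sum.cartesian_product finite_monics finite_tuples_below)
  also have "\<dots> = sum F (tuples_below D (Suc r))"
    by (rule sum.reindex_bij_witness[of _ "\<lambda>as. (degree (hd as), hd as, tl as)"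
          "\<lambda>(d, a, as). a # as"])
       (force simp: tuples_below_def monics_def length_Suc_conv)+
  finally show ?thesis ..
qed

text \<open>As \<open>D \<le> degree P\<close>, all entries are invertible modulo \<open>P\<close>,
  so the inverse of the product splits and the sum factors at the head of the tuple.\<close>

lemma sum_tuples_below_cong_iterated_sum:
  fixes P :: "'a::{finite, field} poly"
  assumes "irreducible P" "D \<le> degree P"
  shows "[(\<Sum>as\<in>tuples_below D (length s).
            inv_mod P (\<Prod>i<length s. powi_mod P (as ! i) (s ! i))) =
          iterated_sum (power_sum P) (\<lambda>_. 1) s D] (mod P)"
  using assms(2)
proof (induction s arbitrary: D)
  case Nil
  have "tuples_below D 0 = {[] :: 'a poly list}" by (auto simp: tuples_below_def)
  thus ?case by (simp add: cong_inv_mod_1 assms(1))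
next
  case (Cons n s)
  let ?Q = "\<lambda>as. \<Prod>i<length s. powi_mod P (as ! i) (s ! i)"
  have "[(\<Sum>as\<in>tuples_below d (length s). inv_mod P (powi_mod P a n * ?Q as)) =
      inv_mod P (powi_mod P a n) * iterated_sum (power_sum P) (\<lambda>_. 1) s d] (mod P)"
    if d: "d < D" and a: "a \<in> monics d" for d a
  proof -
    have "\<not> P dvd ?Q as" if "as \<in> tuples_below d (length s)" for as
    proof -
      have "\<not> P dvd powi_mod P (as ! i) (s ! i)" if "i < length s" for i
      proof (rule not_dvd_powi_mod[OF assms(1) not_dvd_monics[OF assms(1)]])
        have "lead_coeff (as ! i) = 1 \<and> degree (as ! i) < d"
          using \<open>as \<in> _\<close> that by (simp add: tuples_below_def)
        thus "as ! i \<in> monics (degree (as ! i))" "degree (as ! i) < degree P"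
          using d Cons.prems by (auto simp: monics_def)
      qed
      thus ?thesis by (intro not_dvd_prod_irreducible assms(1)) simp
    qed
    moreover have "\<not> P dvd powi_mod P a n"
      using d Cons.prems by (intro not_dvd_powi_mod not_dvd_monics[OF _ a] assms(1)) simp
    ultimately have "[(\<Sum>as\<in>tuples_below d (length s). inv_mod P (powi_mod P a n * ?Q as)) =
        (\<Sum>as\<in>tuples_below d (length s). inv_mod P (powi_mod P a n) * inv_mod P (?Q as))] (mod P)"
      by (intro cong_sum inv_mod_mult assms(1))
    also have "(\<Sum>as\<in>tuples_below d (length s). inv_mod P (powi_mod P a n) * inv_mod P (?Q as)) =
        inv_mod P (powi_mod P a n) * (\<Sum>as\<in>tuples_below d (length s). inv_mod P (?Q as))"
      by (simp add: sum_distrib_left)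
    also have "[\<dots> = inv_mod P (powi_mod P a n) *
        iterated_sum (power_sum P) (\<lambda>_. 1) s d] (mod P)"
      using d Cons.prems by (intro cong_mult cong_refl Cons.IH) simp
    finally show ?thesis .
  qed
  hence "[(\<Sum>d<D. \<Sum>a\<in>monics d. \<Sum>as\<in>tuples_below d (length s).
           inv_mod P (powi_mod P a n * ?Q as)) =
         (\<Sum>d<D. \<Sum>a\<in>monics d.
           inv_mod P (powi_mod P a n) * iterated_sum (power_sum P) (\<lambda>_. 1) s d)] (mod P)"
    by (intro cong_sum) auto
  thus ?case
    by (simp add: sum_tuples_below_Suc prod.lessThan_Suc_shift power_sum_def[where n = n] sum_distrib_right
             del: prod.lessThan_Suc)
qed

lemma finite_mzv_eq_iterated_sum:
  "(finite_mzv s :: 'a::{finite, field} adele) =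
     to_adele (residues (\<lambda>P. iterated_sum (power_sum P) (\<lambda>_. 1) s (degree P)))"
  unfolding finite_mzv_def zeta_tuples_eq
  by (rule to_adele_residues_eqI[of 1])
     (simp_all only: sum_tuples_below_cong_iterated_sum order.refl one_neq_zero not_False_eq_True)

section \<open>Families coming from \<open>k\<close>\<close>

text \<open>These are the families whose class lies in the image of \<open>k\<close>, so that
  multiplying by them is scaling.\<close>

definition rational_family :: "('a::{finite, field} poly \<Rightarrow> 'a poly) \<Rightarrow> bool" where
  "rational_family x \<longleftrightarrow> (\<exists>c. to_adele (residues x) = adele_of_fract c)"

lemma rational_family_const: "rational_family (\<lambda>_. u)"
proof -
  have "to_adele (residues (\<lambda>P. u * inv_mod P 1)) = to_adele (residues (\<lambda>_. u * 1))"
    by (rule to_adele_residues_eqI[of 1])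
       (simp_all only: cong_mult cong_refl cong_inv_mod_1 one_neq_zero not_False_eq_True)
  hence "to_adele (residues (\<lambda>_. u)) = adele_of_fract (Fract u 1)"
    by (simp add: adele_of_fract_Fract)
  thus ?thesis by (auto simp: rational_family_def)
qed

lemma rational_family_add:
  "rational_family x \<Longrightarrow> rational_family y \<Longrightarrow> rational_family (\<lambda>P. x P + y P)"
  unfolding rational_family_def
  by (metis to_adele_residues_add adele_of_fract_add)

lemma rational_family_mult:
  "rational_family x \<Longrightarrow> rational_family y \<Longrightarrow> rational_family (\<lambda>P. x P * y P)"
  unfolding rational_family_def
  by (metis to_adele_residues_mult adele_of_fract_mult)

lemma rational_family_diff:
  assumes "rational_family x" "rational_family y"
  shows "rational_family (\<lambda>P. x P - y P)"
  using rational_family_add[OF assms(1) rational_family_mult[OF rational_family_const[of "- 1"] assms(2)]]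
  by simp

text \<open>The index set is the same for all \<open>P\<close>; hence sums up to a fixed degree stay
  in \<open>k\<close>, while sums up to \<open>degree P\<close> are not covered.\<close>

lemma rational_family_sum:
  "(\<And>i. i \<in> I \<Longrightarrow> rational_family (x i)) \<Longrightarrow> rational_family (\<lambda>P. \<Sum>i\<in>I. x i P)"
  by (induction I rule: infinite_finite_induct)
     (simp_all add: rational_family_const rational_family_add)

lemma rational_family_inv_mod_powi_mod:
  fixes a :: "'a::{finite, field} poly"
  assumes "a \<noteq> 0"
  shows "rational_family (\<lambda>P. inv_mod P (powi_mod P a n))"
proof (cases "n \<ge> 0")
  case True
  with assms have "to_adele (residues (\<lambda>P. inv_mod P (powi_mod P a n))) =
      adele_of_fract (Fract 1 (a ^ nat n))"
    by (simp add: adele_of_fract_Fract powi_mod_def)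
  thus ?thesis by (auto simp: rational_family_def)
next
  case False
  hence "to_adele (residues (\<lambda>P. inv_mod P (powi_mod P a n))) =
      to_adele (residues (\<lambda>_. a ^ nat (- n)))"
    by (intro to_adele_residues_eqI[OF assms] inv_mod_powi_mod_nonpos) simp_all
  thus ?thesis
    using rational_family_const[of "a ^ nat (- n)"] by (simp add: rational_family_def)
qed

lemma rational_family_power_sum:
  "rational_family (\<lambda>P :: 'a::{finite, field} poly. power_sum P d n)"
  unfolding power_sum_def
  by (intro rational_family_sum rational_family_inv_mod_powi_mod) (auto simp: monics_def)

lemma rational_family_iterated_sum:
  "rational_family (\<lambda>P :: 'a::{finite, field} poly. iterated_sum (power_sum P) (\<lambda>_. 1) s d)"
  by (induction s arbitrary: d)
     (auto intro!: rational_family_const rational_family_sum rational_family_mult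
       rational_family_power_sum)

section \<open>Eventually constant weights\<close>

lemma adele_scale_in_span:
  assumes "rational_family x" "y \<in> adele.span B"
  shows "to_adele (residues x) * y \<in> adele.span B"
  using assms adele.span_scale[of y B] by (auto simp: rational_family_def adele_scale_def)

text \<open>The limit of the weight is the class of \<open>g P N\<close>. Constancy is asked only up
  to \<open>degree P\<close>, since beyond it the power sums are not controlled.\<close>

lemma iterated_sum_in_span:
  fixes g :: "'a::{finite, field} poly \<Rightarrow> nat \<Rightarrow> 'a poly"
  assumes "\<And>d. rational_family (\<lambda>P. g P d)"
    and "\<And>P d. irreducible P \<Longrightarrow> N \<le> d \<Longrightarrow> d \<le> degree P \<Longrightarrow> [g P d = g P N] (mod P)"
    and "\<forall>n\<in>set u. n > 0"
  shows "to_adele (residues (\<lambda>P. iterated_sum (power_sum P) (g P) u (degree P))) \<in>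
    adele.span {finite_mzv t | t. \<forall>n\<in>set t. n > 0}"
    (is "_ \<in> adele.span ?B")
  using assms
proof (induction u arbitrary: g rule: rev_induct)
  case Nil
  \<comment> \<open>Only the finitely many \<open>P\<close> of degree below \<open>N\<close> can
    fail the congruence.\<close>
  have "finite {P :: 'a poly. monic_irreducible P \<and> \<not> [g P (degree P) = g P N] (mod P)}"
    by (rule finite_subset[OF _ finite_poly_degree_le[of N]])
       (use Nil.prems(2) nat_le_linear in \<open>auto simp: monic_irreducible_def\<close>)
  hence "to_adele (residues (\<lambda>P. g P (degree P))) = to_adele (residues (\<lambda>P. g P N)) * finite_mzv []"
    by (simp add: to_adele_residues_eq_iff finite_mzv_Nil)
  also have "\<dots> \<in> adele.span ?B"
    by (rule adele_scale_in_span[OF Nil.prems(1)], rule adele.span_base)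
       (auto intro: exI[of _ "[]"])
  finally show ?case by simp
next
  case (snoc n u)
  \<comment> \<open>The terms with \<open>e \<ge> N\<close> vanish modulo \<open>P\<close>, so the
    new weight is constant from the same \<open>N\<close> on.\<close>
  define g' where "g' = (\<lambda>P d. \<Sum>e<d. power_sum P e n * (g P e - g P N))"
  have split: "to_adele (residues (\<lambda>P. iterated_sum (power_sum P) (g P) (u @ [n]) (degree P))) =
      to_adele (residues (\<lambda>P. g P N)) * finite_mzv (u @ [n]) +
      to_adele (residues (\<lambda>P. iterated_sum (power_sum P) (g' P) u (degree P)))"
    unfolding finite_mzv_eq_iterated_sum to_adele_residues_mult to_adele_residues_add g'_def
    by (intro arg_cong[where f = "\<lambda>x. to_adele (residues x)"] ext iterated_sum_snoc_split)
  have "rational_family (\<lambda>P. g' P d)" for d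
    unfolding g'_def
    by (intro rational_family_sum rational_family_mult rational_family_diff
        rational_family_power_sum snoc.prems(1))
  moreover have "[g' P d = g' P N] (mod P)"
    if P: "irreducible P" and d: "N \<le> d" "d \<le> degree P" for P d
  proof -
    have "[(\<Sum>e\<in>{N..<d}. power_sum P e n * (g P e - g P N)) =
        (\<Sum>e\<in>{N..<d}. power_sum P e n * 0)] (mod P)"
      using snoc.prems(2)[OF P] d
      by (intro cong_sum cong_mult cong_refl) (simp add: cong_diff_iff_cong_0)
    moreover have "g' P d = g' P N + (\<Sum>e\<in>{N..<d}. power_sum P e n * (g P e - g P N))"
      unfolding g'_def lessThan_atLeast0 using d by (simp add: sum.atLeastLessThan_concat)
    ultimately show ?thesis
      using cong_add[OF cong_refl[of "g' P N"]] by fastforce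
  qed
  ultimately have
    "to_adele (residues (\<lambda>P. iterated_sum (power_sum P) (g' P) u (degree P))) \<in> adele.span ?B"
    using snoc.prems(3) by (intro snoc.IH) auto
  moreover have "finite_mzv (u @ [n]) \<in> adele.span ?B"
    using snoc.prems(3) by (intro adele.span_base) blast
  ultimately show ?case
    unfolding split by (intro adele.span_add adele_scale_in_span snoc.prems(1))
qed

section \<open>Reduction at the first non-positive entry\<close>

theorem theoremA3:
  fixes s :: "int list"
  assumes "length s \<ge> 1"
  shows "(finite_mzv s :: 'a::{finite, field} adele) \<in>
    adele.span {finite_mzv t | t. \<forall>n\<in>set t. n > 0}"
proof (cases "\<forall>n\<in>set s. n > 0")
  case True
  thus ?thesis by (intro adele.span_base) blast
next
  case False
  hence "\<exists>n\<in>set s. \<not> n > 0" by blast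
  from split_list_first_prop[OF this] obtain u n v
    where s: "s = u @ n # v" and n: "\<not> n > 0" and u: "\<forall>n\<in>set u. n > 0"
    by blast
  from n have n: "n \<le> 0" by simp
  \<comment> \<open>Power sums for \<open>n\<close> vanish in degrees above \<open>-n\<close>, that
    is, from \<open>N\<close> on.\<close>
  define N where "N = Suc (nat (- n))"
  define g :: "'a poly \<Rightarrow> nat \<Rightarrow> 'a poly"
    where "g = (\<lambda>P. iterated_sum (power_sum P) (\<lambda>_. 1) (n # v))"
  have "[g P d = g P N] (mod P)" if P: "irreducible P" and d: "N \<le> d" "d \<le> degree P" for P d
  proof -
    let ?f = "\<lambda>e. power_sum P e n * iterated_sum (power_sum P) (\<lambda>_. 1) v e"
    \<comment> \<open>The vanishing first factor removes these terms whatever the signs of the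
      entries of \<open>v\<close>.\<close>
    have "[sum ?f {N..<d} =
        (\<Sum>e\<in>{N..<d}. 0 * iterated_sum (power_sum P) (\<lambda>_. 1) v e)] (mod P)"
      using d by (intro cong_sum cong_mult cong_refl power_sum_nonpos_cong_0 P n)
        (auto simp: N_def)
    moreover have "g P d = g P N + sum ?f {N..<d}"
      using d by (simp add: g_def lessThan_atLeast0 sum.atLeastLessThan_concat)
    ultimately show ?thesis
      using cong_add[OF cong_refl[of "g P N"]] by fastforce
  qed
  moreover have "rational_family (\<lambda>P. g P d)" for d
    unfolding g_def by (rule rational_family_iterated_sum)
  ultimately have "to_adele (residues (\<lambda>P. iterated_sum (power_sum P) (g P) u (degree P))) \<in>
      adele.span {finite_mzv t | t. \<forall>n\<in>set t. n > 0}"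
    using u by (intro iterated_sum_in_span) auto
  thus ?thesis
    by (simp only: finite_mzv_eq_iterated_sum s iterated_sum_append g_def)
qed

end
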